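(* Let $H$ be a hypergraph, $f:V(H)\to(0,\infty)$ a function, and $M_H$ an $f$-symmetric edge-sum matrix. For any $\mathfrak{R}_2(H,M_H)$-equivalence class $W$ with $|W|\ge 2$, the vector space $C_W^f$ is an invariant subspace of $M_H$, i.e. $M_Hx\in C_W^f$ for all $x\in C_W^f$.
   Context: A hypergraph $H=(V(H),E(H))$ consists of a finite nonempty vertex set $V(H)$ and a finite family $E(H)$ of nonempty subsets of $V(H)$, called hyperedges. The star of a vertex $i$ is $E_i(H)=\{e\in E(H): i\in e\}$. For a vertex $i$, $W_{E_i(H)}=\{k\in V(H): E_k(H)=E_i(H)\}$ (the unit containing $i$). A real matrix $M_H=(m_{ij})_{i,j\in V(H)}$ is an edge-sum matrix if there are maps $p_1,p_2:E(H)\to\mathbb{R}$ (the non-diagonal and diagonal edge-weights) with $m_{ij}=\sum_{e\in E_i(H)\cap E_j(H)}p_1(e)$ for $i\ne j$ and $m_{ii}=\sum_{e\in E_i(H)}p_2(e)$. For $i,j\in V(H)$, a bijection $b_{ij}:E_i(H)\to E_j(H)$ is compatible with the edge-sum matrix $M_H$ if: (1) for every $k\notin W_{E_i(H)}\cup W_{E_j(H)}$, $\sum_{e\in E_i(H)\cap E_k(H)}p_1(e)=\sum_{b_{ij}(e)\in E_j(H)\cap E_k(H)}p_1(b_{ij}(e))$; (2) $\sum_{e\in E_i(H)}p_2(e)=\sum_{b_{ij}(e)\in E_j(H)}p_2(b_{ij}(e))$; (3) $\sum_{e\in E_i(H)}p_1(e)=\sum_{b_{ij}(e)\in E_j(H)}p_1(b_{ij}(e))$;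 (4) $b_{ij}(E_i(H)\cap E_j(H))=E_i(H)\cap E_j(H)$. Here sums indexed by "$b_{ij}(e)\in A$" run over all $e\in E_i(H)$ with $b_{ij}(e)\in A$. $\mathfrak{R}_2(H,M_H)$ is the equivalence relation on $V(H)$ consisting of the pairs $(i,j)$ such that $|W_{E_i(H)}|=|W_{E_j(H)}|$ and there exists a bijection $b_{ij}:E_i(H)\to E_j(H)$ compatible with $M_H$. For $f:V(H)\to(0,\infty)$, let $(x,y)_f=\sum_{i\in V(H)}f(i)x(i)y(i)$ on $\mathbb{R}^{V(H)}$. The matrix $M_H$ is $f$-symmetric if $(M_Hx,y)_f=(x,M_Hy)_f$ for all $x,y\in\mathbb{R}^{V(H)}$. For $U\subseteq V(H)$, $C^f_U=\{x\in\mathbb{R}^{V(H)}: \text{there is } c_x\in\mathbb{R} \text{ with } f(i)x(i)=c_x \text{ for all } i\in U\}$. *)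

theory Defs
  imports "HOL-Analysis.Analysis"
begin

(* A hypergraph is given by a finite (automatically nonempty) type 'v of vertices, V(H) = UNIV,
   and its set E of hyperedges; finiteness of E follows from that of 'v. *)

definition hypergraph :: "'v::finite set set \<Rightarrow> bool" where
  "hypergraph E \<longleftrightarrow> {} \<notin> E"

definition star :: "'v::finite set set \<Rightarrow> 'v \<Rightarrow> 'v set set" where
  "star E i = {e \<in> E. i \<in> e}"

definition vertex_unit :: "'v::finite set set \<Rightarrow> 'v \<Rightarrow> 'v set" where
  "vertex_unit E i = {k. star E k = star E i}"

(* The weights p1 (non-diagonal) and p2 (diagonal) are total functions,
   but only their values on E are ever used. *)

definition edge_sum_matrix ::
    "'v::finite set set \<Rightarrow> ('v set \<Rightarrow> real) \<Rightarrow> ('v set \<Rightarrow> real) \<Rightarrow> real^'v^'v \<Rightarrow> bool" where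
  "edge_sum_matrix E p1 p2 M \<longleftrightarrow>
     (\<forall>i j. i \<noteq> j \<longrightarrow> M $ i $ j = (\<Sum>e\<in>star E i \<inter> star E j. p1 e)) \<and>
     (\<forall>i. M $ i $ i = (\<Sum>e\<in>star E i. p2 e))"

(* Compatibility with an edge-sum matrix refers to its weights, not merely to its entries. *)

definition compatible ::
    "'v::finite set set \<Rightarrow> ('v set \<Rightarrow> real) \<Rightarrow> ('v set \<Rightarrow> real) \<Rightarrow> 'v \<Rightarrow> 'v
      \<Rightarrow> ('v set \<Rightarrow> 'v set) \<Rightarrow> bool" where
  "compatible E p1 p2 i j b \<longleftrightarrow>
     bij_betw b (star E i) (star E j) \<and>
     (\<forall>k. k \<notin> vertex_unit E i \<union> vertex_unit E j \<longrightarrow>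
        (\<Sum>e\<in>star E i \<inter> star E k. p1 e) =
        (\<Sum>e\<in>{e \<in> star E i. b e \<in> star E j \<inter> star E k}. p1 (b e))) \<and>
     (\<Sum>e\<in>star E i. p2 e) = (\<Sum>e\<in>{e \<in> star E i. b e \<in> star E j}. p2 (b e)) \<and>
     (\<Sum>e\<in>star E i. p1 e) = (\<Sum>e\<in>{e \<in> star E i. b e \<in> star E j}. p1 (b e)) \<and>
     b ` (star E i \<inter> star E j) = star E i \<inter> star E j"

definition R2 ::
    "'v::finite set set \<Rightarrow> ('v set \<Rightarrow> real) \<Rightarrow> ('v set \<Rightarrow> real) \<Rightarrow> ('v \<times> 'v) set" where
  "R2 E p1 p2 =
     {(i, j). card (vertex_unit E i) = card (vertex_unit E j) \<and> (\<exists>b. compatible E p1 p2 i j b)}"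

definition weighted_inner :: "('v::finite \<Rightarrow> real) \<Rightarrow> real^'v \<Rightarrow> real^'v \<Rightarrow> real" where
  "weighted_inner f x y = (\<Sum>i\<in>UNIV. f i * x $ i * y $ i)"

definition f_symmetric :: "('v::finite \<Rightarrow> real) \<Rightarrow> real^'v^'v \<Rightarrow> bool" where
  "f_symmetric f M \<longleftrightarrow> (\<forall>x y. weighted_inner f (M *v x) y = weighted_inner f x (M *v y))"

definition C_space :: "('v::finite \<Rightarrow> real) \<Rightarrow> 'v set \<Rightarrow> (real^'v) set" where
  "C_space f U = {x. \<exists>c. \<forall>i\<in>U. f i * x $ i = c}"

definition invariant_subspace :: "real^'v^'v \<Rightarrow> (real^'v::finite) set \<Rightarrow> bool" where
  "invariant_subspace M S \<longleftrightarrow> subspace S \<and> (\<forall>x\<in>S. M *v x \<in> S)"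

lemma sum_bij_restrict:
  fixes p :: "'b \<Rightarrow> real"
  assumes "bij_betw b A B" and "C \<subseteq> B"
  shows "(\<Sum>e\<in>{e \<in> A. b e \<in> C}. p (b e)) = sum p C"
proof -
  have "bij_betw b {e \<in> A. b e \<in> C} C"
    using assms by (auto simp: bij_betw_def inj_on_def)
  then show ?thesis by (rule sum.reindex_bij_betw)
qed

lemma ex_compatible_iff:
  "(\<exists>b. compatible E p1 p2 i j b) \<longleftrightarrow>
     card (star E i) = card (star E j) \<and>
     (\<forall>k. k \<notin> vertex_unit E i \<union> vertex_unit E j \<longrightarrow>
        sum p1 (star E i \<inter> star E k) = sum p1 (star E j \<inter> star E k)) \<and>
     sum p2 (star E i) = sum p2 (star E j) \<and> sum p1 (star E i) = sum p1 (star E j)"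
    (is "?L \<longleftrightarrow> ?R")
proof
  assume ?L
  then obtain b where c: "compatible E p1 p2 i j b" by blast
  then have b: "bij_betw b (star E i) (star E j)" by (simp add: compatible_def)
  show ?R
    using c bij_betw_same_card[OF b] unfolding compatible_def
    by (simp only: sum_bij_restrict[OF b Int_lower1] sum_bij_restrict[OF b subset_refl]) simp
next
  assume R: ?R
  let ?I = "star E i \<inter> star E j"
  have "card (star E i - ?I) = card (star E j - ?I)"
    using R by (simp add: card_Diff_subset)
  then obtain h where h: "bij_betw h (star E i - ?I) (star E j - ?I)"
    by (metis finite finite_same_card_bij)
  let ?b = "\<lambda>e. if e \<in> ?I then e else h e"
  have "bij_betw ?b ?I ?I" by (auto simp: bij_betw_def inj_on_def)
  moreover have "bij_betw ?b (star E i - ?I) (star E j - ?I)"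
    using h by (subst bij_betw_cong[where g = h]) auto
  ultimately have "bij_betw ?b (?I \<union> (star E i - ?I)) (?I \<union> (star E j - ?I))"
    by (rule bij_betw_combine) blast
  then have b: "bij_betw ?b (star E i) (star E j)"
    by (simp add: Un_Diff_cancel Un_absorb1)
  have "?b ` ?I = ?I" by auto
  then have "compatible E p1 p2 i j ?b"
    unfolding compatible_def using R b
    by (simp only: sum_bij_restrict[OF b Int_lower1] sum_bij_restrict[OF b subset_refl]) simp
  then show ?L by blast
qed

lemma equiv_R2: "equiv UNIV (R2 E p1 p2)"
proof (rule equivI)
  show "refl (R2 E p1 p2)"
    by (auto simp: refl_on_def R2_def ex_compatible_iff)
  show "sym (R2 E p1 p2)"
    by (auto simp: sym_def R2_def ex_compatible_iff)
  show "trans (R2 E p1 p2)"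
  proof (rule transI)
    fix i j l
    assume ij: "(i, j) \<in> R2 E p1 p2" and jl: "(j, l) \<in> R2 E p1 p2"
    have *: "sum p1 (star E i \<inter> star E k) = sum p1 (star E l \<inter> star E k)"
      if k: "k \<notin> vertex_unit E i \<union> vertex_unit E l" for k
    proof (cases "star E k = star E j")
      case False
      with k ij jl show ?thesis
        by (auto simp: R2_def ex_compatible_iff vertex_unit_def)
    next
      case True
      with k have ne: "star E j \<noteq> star E i" "star E j \<noteq> star E l"
        by (auto simp: vertex_unit_def)
      show ?thesis
      proof (cases "star E i = star E l")
        case False
        have "sum p1 (star E i \<inter> star E l) = sum p1 (star E j \<inter> star E l)"
          using ij ne False by (auto simp: R2_def ex_compatible_iff vertex_unit_def)
        moreover have "sum p1 (star E j \<inter> star E i) = sum p1 (star E l \<inter> star E i)"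
          using jl ne False by (auto simp: R2_def ex_compatible_iff vertex_unit_def)
        ultimately show ?thesis using True by (simp add: Int_commute)
      qed simp
    qed
    with ij jl show "(i, l) \<in> R2 E p1 p2"
      by (simp add: R2_def ex_compatible_iff)
  qed
qed auto

end

theory Submission
  imports Defs
begin

text \<open>
  An edge-sum matrix is symmetric, because the stars of two vertices enter its off-diagonal
  entries only through their intersection. Being also \<open>f\<close>-symmetric, it satisfies
  \<open>f i * M i k = f k * M i k\<close>: the function \<open>f\<close> is constant along nonzero entries
  (\<open>f_symmetric_edge_sum_entries\<close>). Hence multiplication by \<open>f\<close> commutes with \<open>M\<close>, and it
  turns membership of \<open>x\<close> in the space attached to \<open>W\<close> into plain constancy of
  \<open>y k = f k * x k\<close> on \<open>W\<close>. Such constancy survives \<open>M\<close> as soon as the rows with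
  indices in \<open>W\<close> agree in the columns outside \<open>W\<close> and have equal sums over the columns in \<open>W\<close>
  (\<open>invariant_C_spaceI\<close>).

  Both properties hold for an equivalence class. Let \<open>i, j \<in> W\<close>. The class contains the units
  of \<open>i\<close> and \<open>j\<close>, and for columns outside these two units compatibility equates the entries in
  rows \<open>i\<close> and \<open>j\<close>. What remains is the sum of a row over the two units
  (\<open>R2_row_sum_units\<close>). Inside its own unit, row \<open>i\<close> has one diagonal entry, the total \<open>p2\<close> weight
  of the star, and otherwise the total \<open>p1\<close> weight of the star; over a different unit it is
  constant, equal to the \<open>p1\<close> weight of the common hyperedges. The two stars
  have the same total \<open>p2\<close> weight and the same total \<open>p1\<close> weight, and the two units have the same
  size, which makes these quantities the same for \<open>i\<close> and \<open>j\<close>.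
\<close>

lemma f_symmetric_entries:
  fixes M :: "real^'v^'v"
  assumes "f_symmetric f M"
  shows "f i * M $ i $ j = f j * M $ j $ i"
proof -
  have "weighted_inner f (M *v axis j 1) (axis i 1) = weighted_inner f (axis j 1) (M *v axis i 1)"
    using assms by (simp add: f_symmetric_def)
  then show ?thesis
    unfolding weighted_inner_def matrix_vector_mult_basis column_def
    by (simp add: axis_def mult_delta_left mult_delta_right)
qed

lemma edge_sum_matrix_symmetric:
  assumes "edge_sum_matrix E p1 p2 M"
  shows "M $ i $ j = M $ j $ i"
proof (cases "i = j")
  case False
  then have "M $ i $ j = sum p1 (star E i \<inter> star E j)" "M $ j $ i = sum p1 (star E j \<inter> star E i)"
    using assms by (simp_all add: edge_sum_matrix_def)
  then show ?thesis by (metis Int_commute)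
qed simp

text \<open>
  Symmetry and \<open>f\<close>-symmetry together give \<open>f i = f j\<close> whenever \<open>M $ i $ j\<close> is nonzero; the form
  below covers zero entries as well.
\<close>

lemma f_symmetric_edge_sum_entries:
  assumes "edge_sum_matrix E p1 p2 M" "f_symmetric f M"
  shows "f i * M $ i $ j = f j * M $ i $ j"
  using f_symmetric_entries[OF assms(2), of i j] edge_sum_matrix_symmetric[OF assms(1), of i j]
  by simp

lemma subspace_C_space: "subspace (C_space f U)"
proof (rule subspaceI)
  show "0 \<in> C_space f U" by (auto simp: C_space_def)
next
  fix x y assume "x \<in> C_space f U" "y \<in> C_space f U"
  then obtain c d where "\<forall>i\<in>U. f i * x $ i = c" "\<forall>i\<in>U. f i * y $ i = d"
    by (auto simp: C_space_def)
  then have "\<forall>i\<in>U. f i * (x + y) $ i = c + d" by (simp add: distrib_left)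
  then show "x + y \<in> C_space f U" by (auto simp: C_space_def)
next
  fix a x assume "x \<in> C_space f U"
  then obtain c where "\<forall>i\<in>U. f i * x $ i = c" by (auto simp: C_space_def)
  then have "\<forall>i\<in>U. f i * (a *\<^sub>R x) $ i = a * c" by (simp add: mult.left_commute)
  then show "a *\<^sub>R x \<in> C_space f U" unfolding C_space_def by blast
qed

text \<open>
  For \<open>x\<close> in the space and \<open>i \<in> W\<close>, commuting \<open>f\<close> past \<open>M\<close> writes \<open>f i * (M *v x) $ i\<close> as the
  constant \<open>c\<close> times the row sum over \<open>W\<close>, plus a combination of the entries outside \<open>W\<close>. Neither
  part depends on the choice of \<open>i\<close>.
\<close>

lemma invariant_C_spaceI:
  fixes M :: "real^'v::finite^'v"
  assumes commutes: "\<And>i k. f i * M $ i $ k = f k * M $ i $ k"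
    and outside: "\<And>i j k. i \<in> W \<Longrightarrow> j \<in> W \<Longrightarrow> k \<notin> W \<Longrightarrow> M $ i $ k = M $ j $ k"
    and row_sum: "\<And>i j. i \<in> W \<Longrightarrow> j \<in> W \<Longrightarrow> (\<Sum>k\<in>W. M $ i $ k) = (\<Sum>k\<in>W. M $ j $ k)"
  shows "invariant_subspace M (C_space f W)"
  unfolding invariant_subspace_def
proof (intro conjI ballI)
  fix x assume "x \<in> C_space f W"
  then obtain c where c: "\<And>k. k \<in> W \<Longrightarrow> f k * x $ k = c"
    by (auto simp: C_space_def)
  have expand: "f i * (M *v x) $ i
      = (\<Sum>k\<in>W. M $ i $ k) * c + (\<Sum>k\<in>-W. M $ i $ k * (f k * x $ k))" for i
  proof -
    have "f i * (M *v x) $ i = (\<Sum>k\<in>UNIV. f i * M $ i $ k * x $ k)"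
      by (simp add: matrix_vector_mult_def sum_distrib_left mult.assoc)
    also have "\<dots> = (\<Sum>k\<in>UNIV. M $ i $ k * (f k * x $ k))"
      by (rule sum.cong) (simp_all add: commutes mult_ac)
    also have "\<dots> = (\<Sum>k\<in>W. M $ i $ k * (f k * x $ k)) + (\<Sum>k\<in>-W. M $ i $ k * (f k * x $ k))"
      by (subst sum.union_disjoint[symmetric]) simp_all
    finally show ?thesis
      by (simp add: c sum_distrib_right)
  qed
  have const: "f i * (M *v x) $ i = f j * (M *v x) $ j" if "i \<in> W" "j \<in> W" for i j
  proof -
    have "(\<Sum>k\<in>-W. M $ i $ k * (f k * x $ k)) = (\<Sum>k\<in>-W. M $ j $ k * (f k * x $ k))"
      by (rule sum.cong[OF refl]) (use outside[OF that] in simp)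
    then show ?thesis by (simp only: expand row_sum[OF that])
  qed
  show "M *v x \<in> C_space f W"
  proof (cases "W = {}")
    case False
    then obtain j where "j \<in> W" by blast
    with const have "\<forall>i\<in>W. f i * (M *v x) $ i = f j * (M *v x) $ j" by blast
    then show ?thesis unfolding C_space_def by blast
  qed (simp add: C_space_def)
qed (rule subspace_C_space)

lemma vertex_unit_subset_R2: "vertex_unit E i \<subseteq> R2 E p1 p2 `` {i}"
proof
  fix k assume "k \<in> vertex_unit E i"
  then have "star E k = star E i" by (simp add: vertex_unit_def)
  then show "k \<in> R2 E p1 p2 `` {i}"
    by (simp add: R2_def ex_compatible_iff vertex_unit_def)
qed

lemma R2_entries_eq_outside_units:
  assumes "edge_sum_matrix E p1 p2 M" "(i, j) \<in> R2 E p1 p2"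
    and "k \<notin> vertex_unit E i \<union> vertex_unit E j"
  shows "M $ i $ k = M $ j $ k"
proof -
  have "i \<noteq> k" "j \<noteq> k" using assms(3) by (auto simp: vertex_unit_def)
  then show ?thesis
    using assms by (simp add: edge_sum_matrix_def R2_def ex_compatible_iff)
qed

text \<open>The off-diagonal entries here equal \<open>sum p1 (star E i)\<close>, since \<open>i\<close> and \<open>k\<close> have the same star.\<close>

lemma row_sum_own_unit:
  assumes "edge_sum_matrix E p1 p2 M"
  shows "(\<Sum>k\<in>vertex_unit E i. M $ i $ k)
    = sum p2 (star E i) + (real (card (vertex_unit E i)) - 1) * sum p1 (star E i)"
proof -
  have i: "i \<in> vertex_unit E i" by (simp add: vertex_unit_def)
  have "(\<Sum>k\<in>vertex_unit E i. M $ i $ k) = M $ i $ i + (\<Sum>k\<in>vertex_unit E i - {i}. M $ i $ k)"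
    by (rule sum.remove[OF _ i]) simp
  also have "(\<Sum>k\<in>vertex_unit E i - {i}. M $ i $ k)
      = (\<Sum>k\<in>vertex_unit E i - {i}. sum p1 (star E i))"
  proof (rule sum.cong)
    fix k assume "k \<in> vertex_unit E i - {i}"
    then have "i \<noteq> k" "star E k = star E i" by (auto simp: vertex_unit_def)
    then show "M $ i $ k = sum p1 (star E i)"
      using assms by (simp add: edge_sum_matrix_def)
  qed simp
  also have "\<dots> = (real (card (vertex_unit E i)) - 1) * sum p1 (star E i)"
  proof -
    have "card (vertex_unit E i) \<ge> 1"
      using i by (metis One_nat_def Suc_leI card_gt_0_iff empty_iff finite)
    then show ?thesis using i by (simp add: of_nat_diff)
  qed
  finally show ?thesis
    using assms by (simp add: edge_sum_matrix_def)
qed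

lemma row_sum_other_unit:
  assumes "edge_sum_matrix E p1 p2 M" "star E i \<noteq> star E j"
  shows "(\<Sum>k\<in>vertex_unit E j. M $ i $ k)
    = real (card (vertex_unit E j)) * sum p1 (star E i \<inter> star E j)"
proof -
  have "M $ i $ k = sum p1 (star E i \<inter> star E j)" if "k \<in> vertex_unit E j" for k
  proof -
    have k: "star E k = star E j" using that by (simp add: vertex_unit_def)
    with assms(2) have "i \<noteq> k" by blast
    with assms(1) k show ?thesis by (simp add: edge_sum_matrix_def)
  qed
  then show ?thesis by simp
qed

text \<open>
  Compatibility does not compare the entries in the columns of the two units, where the rows
  \<open>i\<close> and \<open>j\<close> may differ. Their sums over the union agree: the contribution of the own unit
  to row \<open>i\<close> matches that of the own unit to row \<open>j\<close>, and likewise for the other unit.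
\<close>

lemma R2_row_sum_units:
  assumes M: "edge_sum_matrix E p1 p2 M" and ij: "(i, j) \<in> R2 E p1 p2"
  shows "(\<Sum>k\<in>vertex_unit E i \<union> vertex_unit E j. M $ i $ k)
    = (\<Sum>k\<in>vertex_unit E i \<union> vertex_unit E j. M $ j $ k)"
proof -
  have own: "(\<Sum>k\<in>vertex_unit E i. M $ i $ k) = (\<Sum>k\<in>vertex_unit E j. M $ j $ k)"
    using ij by (simp add: row_sum_own_unit[OF M] R2_def ex_compatible_iff)
  show ?thesis
  proof (cases "star E i = star E j")
    case True
    then have "vertex_unit E i = vertex_unit E j" by (simp add: vertex_unit_def)
    with own show ?thesis by simp
  next
    case False
    then have disj: "vertex_unit E i \<inter> vertex_unit E j = {}" by (auto simp: vertex_unit_def)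
    have "(\<Sum>k\<in>vertex_unit E j. M $ i $ k) = (\<Sum>k\<in>vertex_unit E i. M $ j $ k)"
      using ij False row_sum_other_unit[OF M False] row_sum_other_unit[OF M False[symmetric]]
      by (simp add: R2_def Int_commute)
    with own disj show ?thesis by (simp add: sum.union_disjoint)
  qed
qed

theorem theorem2p23:
  fixes E :: "'v::finite set set"
    and p1 p2 :: "'v set \<Rightarrow> real"
    and M :: "real^'v^'v"
    and f :: "'v \<Rightarrow> real"
    and W :: "'v set"
  assumes "hypergraph E"
    and "\<And>i. f i > 0"
    and "edge_sum_matrix E p1 p2 M"
    and "f_symmetric f M"
    and "W \<in> UNIV // R2 E p1 p2"
    and "card W \<ge> 2"
  shows "invariant_subspace M (C_space f W)"
proof (rule invariant_C_spaceI)
  show "f i * M $ i $ k = f k * M $ i $ k" for i k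
    by (rule f_symmetric_edge_sum_entries) fact+
next
  have related: "(i, j) \<in> R2 E p1 p2" if "i \<in> W" "j \<in> W" for i j
    using quotient_eq_iff[OF equiv_R2 assms(5) assms(5) that] by simp
  have unit: "vertex_unit E i \<subseteq> W" if "i \<in> W" for i
  proof -
    have "R2 E p1 p2 `` {i} \<subseteq> W"
      using in_quotient_imp_closed[OF equiv_R2 assms(5) that] by blast
    then show ?thesis using vertex_unit_subset_R2 by blast
  qed
  show "M $ i $ k = M $ j $ k" if "i \<in> W" "j \<in> W" "k \<notin> W" for i j k
    using R2_entries_eq_outside_units[OF assms(3) related[OF that(1,2)]] unit that by blast
  show "(\<Sum>k\<in>W. M $ i $ k) = (\<Sum>k\<in>W. M $ j $ k)" if "i \<in> W" "j \<in> W" for i j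
  proof -
    let ?U = "vertex_unit E i \<union> vertex_unit E j"
    have "?U \<subseteq> W" using unit that by blast
    then have split: "(\<Sum>k\<in>W. M $ l $ k) = (\<Sum>k\<in>W - ?U. M $ l $ k) + (\<Sum>k\<in>?U. M $ l $ k)" for l
      by (intro sum.subset_diff) auto
    have "(\<Sum>k\<in>W - ?U. M $ i $ k) = (\<Sum>k\<in>W - ?U. M $ j $ k)"
      by (rule sum.cong[OF refl], rule R2_entries_eq_outside_units[OF assms(3) related[OF that]]) blast
    then show ?thesis
      using R2_row_sum_units[OF assms(3) related[OF that]] by (simp only: split)
  qed
qed

end
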